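(* Let $\mathbb I=[0,1]$, $Q=\mathbb I\times\mathbb I$, $m$ Lebesgue measure, and let $F:Q\to Q$ be a Borel function of the form $F(x,y)=(T(x),G(x,y))$. Let $\mu$ be an $F$-invariant probability measure with marginal $\mu_x$ on the $x$-axis which is $T$-invariant (and absolutely continuous with respect to Lebesgue measure). Suppose that (1) $(T,\mu_x)$ has exponential convergence to equilibrium with respect to the $L^\infty$ norm $\|\cdot\|_\infty$ and a norm denoted $\|\cdot\|_{\_}$, that is, there are $C_0,\Lambda_0\in\mathbb R^+$, $\Lambda_0<1$, with $$\left|\int f\cdot(g\circ T^n)\,dm-\int g\,d\mu_x\int f\,dm\right|\le C_0\Lambda_0^n\|g\|_\infty\|f\|_{\_},\quad n\ge1,$$ for $f\in L^1(m)$, $g\in L^1(\mu_x)$; (2) $T$ is nonsingular with respect to Lebesgue measure, piecewise continuous and monotonic: there is a finite collection of intervals $\{I_i\}_{i=1,\dots,k}$ with $\bigcup_i I_i=\mathbb I$ such that on each $I_i$, $T$ is a homeomorphism onto its image; (3) $F$ is a contraction on each vertical leaf: $G$ is $\lambda$-Lipschitz in $y$ with $\lambda<1$; (4) there are $C_1,K\in\mathbb R$ and a seminorm $\|\cdot\|_\square$ such that for each $n\ge1$ $$\|\pi(f\circ F^n)\|_{\_}+\|f\circ F^n\|_\square\le C_1K^n\big(\|\pi(f)\|_{\_}+\|f\|_{\updownarrow lip}+\|f\|_\square\big).$$ Then $F$ has exponential decay of correlations: there are $C_2,\Lambda\in\mathbb R^+$, $\Lambda<1$, such that for $n\ge1$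 $$\left|\int f\cdot(g\circ F^n)\,d\mu-\int g\,d\mu\int f\,d\mu\right|\le C_2\Lambda^n\,\|g\|_{\updownarrow lip}\,\big(\|f\|_{\updownarrow lip}+\|\pi(f)\|_{\_}+\|f\|_\square\big)$$ for observables $f,g:Q\to\mathbb R$.
   Context: For $g:Q\to\mathbb R$ (measurable), $\|g\|_{\updownarrow lip}=\|g\|_{\infty!}+\operatorname{Lip}_y(g)$, where $\|g\|_{\infty!}=\sup_{x,y\in[0,1]}|g(x,y)|$ (a true supremum over all points) and $\operatorname{Lip}_y(g)=\sup_{x,\,y_1\ne y_2}\frac{|g(x,y_2)-g(x,y_1)|}{|y_2-y_1|}$. For integrable $f:Q\to\mathbb R$, $\pi(f):\mathbb I\to\mathbb R$ is $\pi(f)(x)=\int_{\mathbb I}f(x,t)\,dt$. $\|\cdot\|_{\_}$ is a given norm for functions on $\mathbb I$, and $\|\cdot\|_\square$ a given seminorm for functions on $Q$; an estimate is understood as void when a quantity on its right-hand side is infinite or undefined.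
   Formalization: The formal theorem additionally assumes that the constant function 1 has finite norm ‖·‖_; without this the claim fails, e.g. for T = id, G = y/2, dμ_x = 2x dx and a norm finite only on multiples of 2x. *)

theory Defs
  imports "HOL-Probability.Probability" "HOL-Probability.Essential_Supremum"
begin

definition unit_I :: "real set" where
  "unit_I = {0..1}"

definition unit_Q :: "(real \<times> real) set" where
  "unit_Q = unit_I \<times> unit_I"

definition borel_I :: "real measure" where
  "borel_I = restrict_space borel unit_I"

definition borel_Q :: "(real \<times> real) measure" where
  "borel_Q = restrict_space borel unit_Q"

definition leb_I :: "real measure" where
  "leb_I = restrict_space lborel unit_I"

definition marginal_x :: "(real \<times> real) measure \<Rightarrow> real measure" where
  "marginal_x \<mu> = distr \<mu> borel_I fst"

(* Functions on I or Q are total functions on real or real * real whose values outside the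
   set A are irrelevant. A (semi)norm that need not be finite, or even defined, on every
   function is [0,\<infinity>]-valued, the value \<infinity> standing for both cases. *)

definition ext_seminorm_on :: "'a set \<Rightarrow> (('a \<Rightarrow> real) \<Rightarrow> ennreal) \<Rightarrow> bool" where
  "ext_seminorm_on A N \<longleftrightarrow>
     (\<forall>f g. (\<forall>x\<in>A. f x = g x) \<longrightarrow> N f = N g) \<and>
     (\<forall>c f. N (\<lambda>x. c * f x) = ennreal \<bar>c\<bar> * N f) \<and>
     (\<forall>f g. N (\<lambda>x. f x + g x) \<le> N f + N g)"

(* Definiteness is required only up to Lebesgue null sets, so that both norms of genuine
   functions and norms of almost-everywhere classes are covered. *)

definition ext_norm_on_I :: "((real \<Rightarrow> real) \<Rightarrow> ennreal) \<Rightarrow> bool" where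
  "ext_norm_on_I N \<longleftrightarrow>
     ext_seminorm_on unit_I N \<and> (\<forall>f. N f = 0 \<longrightarrow> (AE x in leb_I. f x = 0))"

definition Linf_norm :: "(real \<Rightarrow> real) \<Rightarrow> ennreal" where
  "Linf_norm g = esssup leb_I (\<lambda>x. ennreal \<bar>g x\<bar>)"

definition sup_norm_Q :: "(real \<times> real \<Rightarrow> real) \<Rightarrow> ennreal" where
  "sup_norm_Q g = (SUP p\<in>unit_Q. ennreal \<bar>g p\<bar>)"

definition Lip_y :: "(real \<times> real \<Rightarrow> real) \<Rightarrow> ennreal" where
  "Lip_y g = (SUP (x, y1, y2)\<in>{(x, y1, y2). x \<in> unit_I \<and> y1 \<in> unit_I \<and> y2 \<in> unit_I \<and> y1 \<noteq> y2}.
     ennreal (\<bar>g (x, y2) - g (x, y1)\<bar> / \<bar>y2 - y1\<bar>))"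

definition ylip_norm :: "(real \<times> real \<Rightarrow> real) \<Rightarrow> ennreal" where
  "ylip_norm g = sup_norm_Q g + Lip_y g"

definition proj_x :: "(real \<times> real \<Rightarrow> real) \<Rightarrow> real \<Rightarrow> real" where
  "proj_x f x = (\<integral>t. f (x, t) \<partial>leb_I)"

definition nonsingular_I :: "(real \<Rightarrow> real) \<Rightarrow> bool" where
  "nonsingular_I T \<longleftrightarrow>
     T \<in> borel_I \<rightarrow>\<^sub>M borel_I \<and> (\<forall>A\<in>null_sets leb_I. T -` A \<inter> unit_I \<in> null_sets leb_I)"

definition piecewise_homeo_I :: "(real \<Rightarrow> real) \<Rightarrow> bool" where
  "piecewise_homeo_I T \<longleftrightarrow>
     (\<exists>(k::nat) J. (\<forall>i\<in>{1..k}. is_interval (J i)) \<and> (\<Union>i\<in>{1..k}. J i) = unit_I \<and>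
        (\<forall>i\<in>{1..k}. \<exists>h. homeomorphism (J i) (T ` J i) T h))"

(* In the three estimates below, the finiteness premises express that an estimate claims
   nothing when its right-hand side is infinite or undefined. *)

definition exp_convergence_to_equilibrium ::
  "(real \<Rightarrow> real) \<Rightarrow> real measure \<Rightarrow> ((real \<Rightarrow> real) \<Rightarrow> ennreal) \<Rightarrow> bool" where
  "exp_convergence_to_equilibrium T \<nu> N \<longleftrightarrow>
     (\<exists>C \<Lambda>::real. 0 < C \<and> 0 < \<Lambda> \<and> \<Lambda> < 1 \<and>
        (\<forall>f g. \<forall>n\<ge>1. integrable leb_I f \<longrightarrow> integrable \<nu> g \<longrightarrow>
           Linf_norm g < \<infinity> \<longrightarrow> N f < \<infinity> \<longrightarrow>
           ennreal \<bar>(\<integral>x. f x * g ((T ^^ n) x) \<partial>leb_I) - (\<integral>x. g x \<partial>\<nu>) * (\<integral>x. f x \<partial>leb_I)\<bar>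
             \<le> ennreal (C * \<Lambda> ^ n) * Linf_norm g * N f))"

(* C and K are arbitrary reals; ennreal truncates a negative C * K ^ n to 0, which can only
   weaken the condition. *)

definition iterate_norm_growth ::
  "(real \<times> real \<Rightarrow> real \<times> real) \<Rightarrow> ((real \<Rightarrow> real) \<Rightarrow> ennreal) \<Rightarrow>
   ((real \<times> real \<Rightarrow> real) \<Rightarrow> ennreal) \<Rightarrow> bool" where
  "iterate_norm_growth F N S \<longleftrightarrow>
     (\<exists>C K::real. \<forall>f\<in>borel_measurable borel_Q. \<forall>n\<ge>1.
        N (proj_x f) < \<infinity> \<longrightarrow> ylip_norm f < \<infinity> \<longrightarrow> S f < \<infinity> \<longrightarrow>
        N (proj_x (f \<circ> (F ^^ n))) + S (f \<circ> (F ^^ n))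
          \<le> ennreal (C * K ^ n) * (N (proj_x f) + ylip_norm f + S f))"

definition exp_decay_of_correlations ::
  "(real \<times> real \<Rightarrow> real \<times> real) \<Rightarrow> (real \<times> real) measure \<Rightarrow> ((real \<Rightarrow> real) \<Rightarrow> ennreal) \<Rightarrow>
   ((real \<times> real \<Rightarrow> real) \<Rightarrow> ennreal) \<Rightarrow> bool" where
  "exp_decay_of_correlations F \<mu> N S \<longleftrightarrow>
     (\<exists>C \<Lambda>::real. 0 < C \<and> 0 < \<Lambda> \<and> \<Lambda> < 1 \<and>
        (\<forall>f\<in>borel_measurable borel_Q. \<forall>g\<in>borel_measurable borel_Q. \<forall>n\<ge>1.
           ylip_norm g < \<infinity> \<longrightarrow> ylip_norm f < \<infinity> \<longrightarrow> N (proj_x f) < \<infinity> \<longrightarrow> S f < \<infinity> \<longrightarrow>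
           ennreal \<bar>(\<integral>p. f p * g ((F ^^ n) p) \<partial>\<mu>) - (\<integral>p. g p \<partial>\<mu>) * (\<integral>p. f p \<partial>\<mu>)\<bar>
             \<le> ennreal (C * \<Lambda> ^ n) * ylip_norm g * (ylip_norm f + N (proj_x f) + S f)))"

end

theory Submission
  imports Defs
begin

text \<open>
  Since \<open>F\<close> contracts the vertical leaves, \<open>g \<circ> F\<^sup>k\<close> is up to an error \<open>\<lambda>\<^sup>k\<close> a function of \<open>x\<close> alone,
  so convergence to equilibrium of \<open>T\<close> lifts to convergence to equilibrium of \<open>F\<close> with respect to
  two-dimensional Lebesgue measure \<open>Leb\<close>. For the correlations with respect to \<open>\<mu>\<close>, write
  \<open>h = f \<cdot> (g \<circ> F\<^sup>n)\<close>, whose Lipschitz norm in \<open>y\<close> is bounded uniformly in \<open>n\<close>; then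
  \<open>\<integral>h d\<mu> \<approx> \<integral>h \<circ> F\<^sup>m dLeb = \<integral>(f \<circ> F\<^sup>m) \<cdot> (g \<circ> F\<^bsup>n+m\<^esup>) dLeb \<approx> \<integral>g d\<mu> \<integral>f \<circ> F\<^sup>m dLeb \<approx> \<integral>g d\<mu> \<integral>f d\<mu>\<close>.
  The middle step costs a factor \<open>K\<^sup>m\<close>, which is absorbed by taking \<open>m\<close> to be a small fraction of \<open>n\<close>.
\<close>

section \<open>Lebesgue measure on the square and Borel measurability\<close>

definition leb_Q :: "(real \<times> real) measure" where
  "leb_Q = leb_I \<Otimes>\<^sub>M leb_I"

lemma sets_leb_I: "sets leb_I = sets borel_I"
  by (simp add: leb_I_def borel_I_def sets_restrict_space)

lemma space_leb_I [simp]: "space leb_I = unit_I"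
  by (simp add: leb_I_def space_restrict_space)

lemma space_borel_I [simp]: "space borel_I = unit_I"
  by (simp add: borel_I_def space_restrict_space)

lemma space_borel_Q [simp]: "space borel_Q = unit_Q"
  by (simp add: borel_Q_def space_restrict_space)

lemma space_leb_Q [simp]: "space leb_Q = unit_Q"
  by (simp add: leb_Q_def space_pair_measure unit_Q_def)

lemma prob_space_leb_I: "prob_space leb_I"
  by (rule prob_spaceI) (simp add: leb_I_def space_restrict_space emeasure_restrict_space unit_I_def)

lemma pair_prob_space_leb_I: "pair_prob_space leb_I leb_I"
  using prob_space_leb_I
  by (simp add: pair_prob_space_def pair_sigma_finite_def prob_space_imp_sigma_finite)

lemma prob_space_leb_Q: "prob_space leb_Q"
proof -
  interpret pair_prob_space leb_I leb_I by (rule pair_prob_space_leb_I)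
  show ?thesis unfolding leb_Q_def by (rule P.prob_space_axioms)
qed

text \<open>Borel maps into the plane are recognised by their coordinates. This lets Borel
  observables be integrated against \<open>leb_Q\<close>, which is built as a product so that
  Fubini's theorem produces \<open>proj_x\<close>.\<close>

lemma measurable_leb_Q_ident: "(\<lambda>p. p) \<in> leb_Q \<rightarrow>\<^sub>M borel_Q"
proof -
  have fst: "fst \<in> leb_Q \<rightarrow>\<^sub>M borel" and snd: "snd \<in> leb_Q \<rightarrow>\<^sub>M borel"
    unfolding leb_Q_def leb_I_def
    by (auto intro!: measurable_compose[OF measurable_fst] measurable_compose[OF measurable_snd]
        measurable_restrict_space1)
  have "(\<lambda>p. (fst p, snd p)) \<in> leb_Q \<rightarrow>\<^sub>M (borel :: (real \<times> real) measure)"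
    using fst snd by (intro borel_measurable_Pair)
  then show ?thesis
    unfolding borel_Q_def by (intro measurable_restrict_space2) auto
qed

lemma measurable_leb_Q: "f \<in> borel_Q \<rightarrow>\<^sub>M M \<Longrightarrow> f \<in> leb_Q \<rightarrow>\<^sub>M M"
  by (rule measurable_compose[OF measurable_leb_Q_ident])

lemma measurable_fst_borel_Q: "fst \<in> borel_Q \<rightarrow>\<^sub>M borel_I"
  unfolding borel_Q_def borel_I_def
  by (rule measurable_restrict_space3)
    (auto simp: unit_Q_def intro!: borel_measurable_continuous_onI continuous_intros)

lemma measurable_horizontal_borel_Q: "y \<in> unit_I \<Longrightarrow> (\<lambda>x. (x, y)) \<in> borel_I \<rightarrow>\<^sub>M borel_Q"
  unfolding borel_Q_def borel_I_def
  by (rule measurable_restrict_space3) (auto simp: unit_Q_def)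

lemma measurable_funpow:
  assumes "f \<in> M \<rightarrow>\<^sub>M M"
  shows "f ^^ n \<in> M \<rightarrow>\<^sub>M M"
proof (induction n)
  case 0
  then show ?case by (simp add: id_def)
next
  case (Suc n)
  then show ?case using assms by (auto intro: measurable_comp)
qed

section \<open>Integrals of bounded functions over probability spaces\<close>

lemma (in prob_space) integrable_bounded:
  fixes f :: "'a \<Rightarrow> real"
  assumes "f \<in> borel_measurable M" and "\<And>x. x \<in> space M \<Longrightarrow> \<bar>f x\<bar> \<le> B"
  shows "integrable M f"
  using assms by (intro integrable_const_bound[where B = B] AE_I2) auto

lemma (in prob_space) abs_integral_diff_le:
  fixes f g :: "'a \<Rightarrow> real"
  assumes "integrable M f" and "integrable M g" and "\<And>x. x \<in> space M \<Longrightarrow> \<bar>f x - g x\<bar> \<le> e"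
  shows "\<bar>(\<integral>x. f x \<partial>M) - (\<integral>x. g x \<partial>M)\<bar> \<le> e"
proof -
  have "\<bar>\<integral>x. f x - g x \<partial>M\<bar> \<le> (\<integral>x. \<bar>f x - g x\<bar> \<partial>M)"
    by (rule integral_abs_bound)
  also have "\<dots> \<le> e"
    using assms by (intro integral_le_const AE_I2) auto
  finally show ?thesis using assms by simp
qed

lemma (in prob_space) abs_integral_le:
  fixes f :: "'a \<Rightarrow> real"
  assumes "f \<in> borel_measurable M" and "\<And>x. x \<in> space M \<Longrightarrow> \<bar>f x\<bar> \<le> e"
  shows "\<bar>\<integral>x. f x \<partial>M\<bar> \<le> e"
  using abs_integral_diff_le[of f "\<lambda>_. 0" e] integrable_bounded[OF assms] assms by simp

section \<open>Real pointwise bounds extracted from the extended norms\<close>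

lemma abs_le_sup_norm_Q:
  assumes "sup_norm_Q g < \<infinity>" and "p \<in> unit_Q"
  shows "\<bar>g p\<bar> \<le> enn2real (sup_norm_Q g)"
proof -
  have "ennreal \<bar>g p\<bar> \<le> sup_norm_Q g"
    unfolding sup_norm_Q_def using assms(2) by (rule SUP_upper)
  then show ?thesis
    using enn2real_mono[OF _ assms(1)[unfolded infinity_ennreal_def]] by fastforce
qed

lemma abs_diff_le_Lip_y:
  assumes "Lip_y g < \<infinity>" and "x \<in> unit_I" "y1 \<in> unit_I" "y2 \<in> unit_I"
  shows "\<bar>g (x, y2) - g (x, y1)\<bar> \<le> enn2real (Lip_y g) * \<bar>y2 - y1\<bar>"
proof (cases "y1 = y2")
  case False
  have "ennreal (\<bar>g (x, y2) - g (x, y1)\<bar> / \<bar>y2 - y1\<bar>) \<le> Lip_y g"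
    unfolding Lip_y_def using assms False by (intro SUP_upper2[of "(x, y1, y2)"]) auto
  then have "\<bar>g (x, y2) - g (x, y1)\<bar> / \<bar>y2 - y1\<bar> \<le> enn2real (Lip_y g)"
    using enn2real_mono[OF _ assms(1)[unfolded infinity_ennreal_def]] by fastforce
  then show ?thesis
    using False by (simp add: divide_simps)
qed simp

section \<open>Skew products contracting the vertical leaves\<close>

text \<open>One constant \<open>L\<close> serves both as contraction rate of the leaves and as
  convergence rate of \<open>T\<close>, so that a single exponential has to be tracked; its
  positivity permits division by its square root. \<open>base_equilibrium\<close> is phrased in real
  numbers, with a pointwise bound \<open>B\<close> in the role of the essential supremum.\<close>

locale skew_contraction = prob_space \<mu>
  for \<mu> :: "(real \<times> real) measure" +
  fixes F :: "real \<times> real \<Rightarrow> real \<times> real"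
    and T :: "real \<Rightarrow> real"
    and G :: "real \<times> real \<Rightarrow> real"
    and N :: "(real \<Rightarrow> real) \<Rightarrow> ennreal"
    and L :: real
    and C\<^sub>0 :: real
  assumes F_meas: "F \<in> borel_Q \<rightarrow>\<^sub>M borel_Q"
    and T_meas: "T \<in> borel_I \<rightarrow>\<^sub>M borel_I"
    and F_skew: "\<And>x y. x \<in> unit_I \<Longrightarrow> y \<in> unit_I \<Longrightarrow> F (x, y) = (T x, G (x, y))"
    and sets_mu: "sets \<mu> = sets borel_Q"
    and mu_inv: "distr \<mu> \<mu> F = \<mu>"
    and L_pos: "0 < L" and L_less: "L < 1" and C\<^sub>0_pos: "0 < C\<^sub>0"
    and G_lip: "\<And>x. x \<in> unit_I \<Longrightarrow> L-lipschitz_on unit_I (\<lambda>y. G (x, y))"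
    and base_equilibrium: "\<And>f g n B. integrable leb_I f \<Longrightarrow> g \<in> borel_measurable borel_I \<Longrightarrow>
      (\<And>x. x \<in> unit_I \<Longrightarrow> \<bar>g x\<bar> \<le> B) \<Longrightarrow> N f < \<infinity> \<Longrightarrow> 1 \<le> n \<Longrightarrow>
      \<bar>(\<integral>x. f x * g ((T ^^ n) x) \<partial>leb_I) - (\<integral>x. g x \<partial>marginal_x \<mu>) * (\<integral>x. f x \<partial>leb_I)\<bar>
        \<le> C\<^sub>0 * L ^ n * B * enn2real (N f)"
begin

lemma space_mu [simp]: "space \<mu> = unit_Q"
  using sets_eq_imp_space_eq[OF sets_mu] by simp

lemma measurable_mu: "f \<in> borel_Q \<rightarrow>\<^sub>M M \<Longrightarrow> f \<in> \<mu> \<rightarrow>\<^sub>M M"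
  using measurable_cong_sets[OF sets_mu refl] by blast

lemmas Fn_meas = measurable_funpow[OF F_meas]

lemma Fn_in_Q: "p \<in> unit_Q \<Longrightarrow> (F ^^ n) p \<in> unit_Q"
  using measurable_space[OF Fn_meas[of n], of p] by simp

lemma fst_Fn: "p \<in> unit_Q \<Longrightarrow> fst ((F ^^ n) p) = (T ^^ n) (fst p)"
proof (induction n)
  case (Suc n)
  then show ?case
    using Fn_in_Q[of p n] F_skew[of "fst ((F ^^ n) p)" "snd ((F ^^ n) p)"]
    by (auto simp: unit_Q_def)
qed simp

text \<open>By \<open>fst_Fn\<close>, two points of one vertical leaf have all their iterates on a
  common leaf, so each iteration contributes one factor \<open>L\<close> from
  \<open>G_lip\<close>.\<close>

lemma Fn_contraction:
  assumes "x \<in> unit_I" "y1 \<in> unit_I" "y2 \<in> unit_I"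
  shows "\<bar>snd ((F ^^ n) (x, y2)) - snd ((F ^^ n) (x, y1))\<bar> \<le> L ^ n * \<bar>y2 - y1\<bar>"
proof (induction n)
  case (Suc n)
  define p where "p = (F ^^ n) (x, y1)"
  define q where "q = (F ^^ n) (x, y2)"
  have Q: "p \<in> unit_Q" "q \<in> unit_Q"
    using assms by (auto simp: p_def q_def unit_Q_def intro!: Fn_in_Q[unfolded unit_Q_def])
  have fst: "fst q = fst p"
    using assms by (simp add: p_def q_def fst_Fn unit_Q_def)
  have "snd (F q) = G (fst p, snd q)" "snd (F p) = G (fst p, snd p)"
    using Q fst F_skew[of "fst p" "snd q"] F_skew[of "fst p" "snd p"]
    by (metis mem_Times_iff prod.collapse snd_conv unit_Q_def)+
  then have "\<bar>snd (F q) - snd (F p)\<bar> \<le> L * \<bar>snd q - snd p\<bar>"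
    using lipschitz_onD[OF G_lip, of "fst p" "snd q" "snd p"] Q
    by (auto simp: unit_Q_def dist_real_def)
  also have "\<dots> \<le> L * (L ^ n * \<bar>y2 - y1\<bar>)"
    using Suc L_pos by (simp add: p_def q_def)
  finally show ?case by (simp add: p_def q_def)
qed simp

text \<open>Serves two purposes: for large \<open>n\<close> it makes an observable nearly constant
  on leaves, and since \<open>L ^ n\<close> is at most 1 it keeps Lipschitz constants in y uniform
  in \<open>n\<close>.\<close>

lemma abs_diff_comp_Fn_le:
  assumes lip: "\<And>x y1 y2. x \<in> unit_I \<Longrightarrow> y1 \<in> unit_I \<Longrightarrow> y2 \<in> unit_I \<Longrightarrow>
      \<bar>g (x, y2) - g (x, y1)\<bar> \<le> H * \<bar>y2 - y1\<bar>"
    and H: "0 \<le> H"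
    and I: "x \<in> unit_I" "y1 \<in> unit_I" "y2 \<in> unit_I"
  shows "\<bar>g ((F ^^ n) (x, y2)) - g ((F ^^ n) (x, y1))\<bar> \<le> H * L ^ n * \<bar>y2 - y1\<bar>"
proof -
  define p where "p = (F ^^ n) (x, y1)"
  define q where "q = (F ^^ n) (x, y2)"
  have Q: "p \<in> unit_Q" "q \<in> unit_Q"
    using I by (auto simp: p_def q_def unit_Q_def intro!: Fn_in_Q[unfolded unit_Q_def])
  have fst: "fst q = fst p"
    using I by (simp add: p_def q_def fst_Fn unit_Q_def)
  have "\<bar>g q - g p\<bar> \<le> H * \<bar>snd q - snd p\<bar>"
    using lip[of "fst p" "snd p" "snd q"] Q fst
    by (metis mem_Times_iff prod.collapse unit_Q_def)
  also have "\<dots> \<le> H * (L ^ n * \<bar>y2 - y1\<bar>)"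
    using Fn_contraction[OF I, of n] H by (simp add: p_def q_def mult_left_mono)
  finally show ?thesis by (simp add: p_def q_def mult.assoc)
qed

lemma integral_comp_F:
  fixes g :: "real \<times> real \<Rightarrow> real"
  assumes "g \<in> borel_measurable borel_Q"
  shows "(\<integral>p. g (F p) \<partial>\<mu>) = (\<integral>p. g p \<partial>\<mu>)"
proof -
  have "F \<in> \<mu> \<rightarrow>\<^sub>M \<mu>"
    using measurable_cong_sets[OF sets_mu sets_mu] F_meas by blast
  then have "(\<integral>p. g p \<partial>distr \<mu> \<mu> F) = (\<integral>p. g (F p) \<partial>\<mu>)"
    by (rule integral_distr[OF _ measurable_mu[OF assms]])
  then show ?thesis by (simp add: mu_inv)
qed

lemma integral_comp_Fn:
  fixes g :: "real \<times> real \<Rightarrow> real"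
  assumes "g \<in> borel_measurable borel_Q"
  shows "(\<integral>p. g ((F ^^ n) p) \<partial>\<mu>) = (\<integral>p. g p \<partial>\<mu>)"
proof (induction n)
  case (Suc n)
  have "(\<lambda>p. g ((F ^^ n) p)) \<in> borel_measurable borel_Q"
    using Fn_meas assms by (rule measurable_compose)
  from integral_comp_F[OF this] Suc show ?case
    by (simp add: funpow_swap1)
qed simp

section \<open>Convergence to equilibrium relative to Lebesgue measure\<close>

text \<open>The last \<open>k\<close> iterates flatten \<open>g\<close> to a function of x up to an
  error \<open>H * L ^ k\<close>; on such a function the first \<open>j\<close> iterates act through
  \<open>T\<close> alone, where \<open>base_equilibrium\<close> applies. The flattening error is
  paid twice, once under \<open>leb_Q\<close> and once under \<open>\<mu>\<close>.\<close>

lemma skew_equilibrium_split: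
  assumes f: "f \<in> borel_measurable borel_Q" and g: "g \<in> borel_measurable borel_Q"
    and bf: "\<And>p. p \<in> unit_Q \<Longrightarrow> \<bar>f p\<bar> \<le> A" and bg: "\<And>p. p \<in> unit_Q \<Longrightarrow> \<bar>g p\<bar> \<le> B"
    and lip: "\<And>x y1 y2. x \<in> unit_I \<Longrightarrow> y1 \<in> unit_I \<Longrightarrow> y2 \<in> unit_I \<Longrightarrow>
      \<bar>g (x, y2) - g (x, y1)\<bar> \<le> H * \<bar>y2 - y1\<bar>"
    and H: "0 \<le> H" and Nf: "N (proj_x f) < \<infinity>" and j: "1 \<le> j"
  shows "\<bar>(\<integral>p. f p * g ((F ^^ (j + k)) p) \<partial>leb_Q) - (\<integral>p. g p \<partial>\<mu>) * (\<integral>p. f p \<partial>leb_Q)\<bar>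
      \<le> 2 * A * H * L ^ k + C\<^sub>0 * L ^ j * B * enn2real (N (proj_x f))"
proof -
  interpret I: prob_space leb_I by (rule prob_space_leb_I)
  interpret Q: prob_space leb_Q by (rule prob_space_leb_Q)
  interpret P: pair_prob_space leb_I leb_I by (rule pair_prob_space_leb_I)
  have 0: "(0::real) \<in> unit_I" by (simp add: unit_I_def)
  have 00: "(0::real, 0::real) \<in> unit_Q" by (simp add: unit_Q_def unit_I_def)
  have A: "0 \<le> A" using bf[OF 00] by linarith
  \<comment> \<open>The flattened observable samples each leaf at height 0; any fixed height would
    do.\<close>
  define u where "u x = g ((F ^^ k) (x, 0))" for x
  have u: "u \<in> borel_measurable borel_I"
    unfolding u_def
    using measurable_compose[OF measurable_horizontal_borel_Q[OF 0] measurable_compose[OF Fn_meas g]] .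
  have bu: "\<bar>u x\<bar> \<le> B" if "x \<in> unit_I" for x
    unfolding u_def using that 0 by (intro bg Fn_in_Q) (simp add: unit_Q_def)
  have close: "\<bar>g ((F ^^ k) p) - u (fst p)\<bar> \<le> H * L ^ k" if "p \<in> unit_Q" for p
  proof -
    from that obtain x y where p: "p = (x, y)" "x \<in> unit_I" "y \<in> unit_I"
      by (auto simp: unit_Q_def)
    have "\<bar>g ((F ^^ k) (x, y)) - g ((F ^^ k) (x, 0))\<bar> \<le> H * L ^ k * \<bar>y - 0\<bar>"
      using p 0 by (intro abs_diff_comp_Fn_le lip H) auto
    \<comment> \<open>Leaves have length 1.\<close>
    also have "\<dots> \<le> H * L ^ k * 1"
      using p(3) H L_pos by (intro mult_left_mono) (auto simp: unit_I_def)
    finally show ?thesis by (simp add: p u_def)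
  qed
  have Tj: "T ^^ j \<in> borel_I \<rightarrow>\<^sub>M borel_I" by (rule measurable_funpow[OF T_meas])
  have Tj_in: "(T ^^ j) x \<in> unit_I" if "x \<in> unit_I" for x
    using measurable_space[OF Tj, of x] that by simp
  have gF: "(\<lambda>p. g ((F ^^ n) p)) \<in> borel_measurable borel_Q" for n
    using Fn_meas g by (rule measurable_compose)
  have uT: "(\<lambda>p. u ((T ^^ j) (fst p))) \<in> borel_measurable borel_Q"
    using measurable_compose[OF measurable_fst_borel_Q measurable_compose[OF Tj u]] .
  have int_fg: "integrable leb_Q (\<lambda>p. f p * g ((F ^^ n) p))" for n
    using measurable_leb_Q[OF f] measurable_leb_Q[OF gF[of n]] bf bg[OF Fn_in_Q]
    by (intro Q.integrable_bounded[where B = "A * B"])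
      (auto simp: abs_mult A intro!: mult_mono)
  have int_fu: "integrable leb_Q (\<lambda>p. f p * u ((T ^^ j) (fst p)))"
    using measurable_leb_Q[OF f] measurable_leb_Q[OF uT] bf bu[OF Tj_in]
    by (intro Q.integrable_bounded[where B = "A * B"])
      (auto simp: abs_mult A unit_Q_def intro!: mult_mono)
  have int_f: "integrable leb_Q f"
    using measurable_leb_Q[OF f] bf by (intro Q.integrable_bounded) auto
  have step1: "\<bar>(\<integral>p. f p * g ((F ^^ (j + k)) p) \<partial>leb_Q) - (\<integral>p. f p * u ((T ^^ j) (fst p)) \<partial>leb_Q)\<bar>
      \<le> A * (H * L ^ k)"
  proof (rule Q.abs_integral_diff_le[OF int_fg int_fu])
    fix p assume "p \<in> space leb_Q"
    then have p: "p \<in> unit_Q" by simp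
    have "(F ^^ (j + k)) p = (F ^^ k) ((F ^^ j) p)"
      by (subst add.commute) (simp add: funpow_add)
    then have "\<bar>g ((F ^^ (j + k)) p) - u ((T ^^ j) (fst p))\<bar> \<le> H * L ^ k"
      using close[OF Fn_in_Q[OF p, of j]] fst_Fn[OF p, of j] by simp
    then show "\<bar>f p * g ((F ^^ (j + k)) p) - f p * u ((T ^^ j) (fst p))\<bar> \<le> A * (H * L ^ k)"
      using bf[OF p] A by (simp add: right_diff_distrib[symmetric] abs_mult mult_mono)
  qed
  \<comment> \<open>The factor containing \<open>u\<close> is constant on leaves, so integrating
    over y turns \<open>f\<close> into \<open>proj_x f\<close>; this is how
    \<open>N (proj_x f)\<close> enters.\<close>
  have fubini1: "(\<integral>p. f p * u ((T ^^ j) (fst p)) \<partial>leb_Q) = (\<integral>x. proj_x f x * u ((T ^^ j) x) \<partial>leb_I)"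
    using P.integral_fst'[OF int_fu[unfolded leb_Q_def]]
    by (simp add: leb_Q_def proj_x_def)
  have fubini2: "(\<integral>p. f p \<partial>leb_Q) = (\<integral>x. proj_x f x \<partial>leb_I)"
    using P.integral_fst'[OF int_f[unfolded leb_Q_def]]
    by (simp add: leb_Q_def proj_x_def)
  have int_proj: "integrable leb_I (proj_x f)"
    using P.integrable_fst'[OF int_f[unfolded leb_Q_def]]
    by (simp add: proj_x_def[abs_def])
  have step2: "\<bar>(\<integral>x. proj_x f x * u ((T ^^ j) x) \<partial>leb_I)
      - (\<integral>x. u x \<partial>marginal_x \<mu>) * (\<integral>x. proj_x f x \<partial>leb_I)\<bar>
      \<le> C\<^sub>0 * L ^ j * B * enn2real (N (proj_x f))"
    using int_proj u bu Nf j by (rule base_equilibrium)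
  have marg: "(\<integral>x. u x \<partial>marginal_x \<mu>) = (\<integral>p. u (fst p) \<partial>\<mu>)"
    unfolding marginal_x_def by (rule integral_distr[OF measurable_mu[OF measurable_fst_borel_Q] u])
  have ufst: "(\<lambda>p. u (fst p)) \<in> borel_measurable borel_Q"
    using measurable_compose[OF measurable_fst_borel_Q u] .
  \<comment> \<open>The limit still involves \<open>u\<close>. Invariance of \<open>\<mu>\<close>
    replaces the integral of \<open>g\<close> composed with the \<open>k\<close>-th iterate by that
    of \<open>g\<close> itself.\<close>
  have "\<bar>(\<integral>p. u (fst p) \<partial>\<mu>) - (\<integral>p. g ((F ^^ k) p) \<partial>\<mu>)\<bar> \<le> H * L ^ k"
  proof (rule abs_integral_diff_le)
    show "integrable \<mu> (\<lambda>p. u (fst p))"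
      using measurable_mu[OF ufst] bu by (intro integrable_bounded) (auto simp: unit_Q_def)
    show "integrable \<mu> (\<lambda>p. g ((F ^^ k) p))"
      using measurable_mu[OF gF] bg[OF Fn_in_Q] by (intro integrable_bounded) auto
    show "\<bar>u (fst p) - g ((F ^^ k) p)\<bar> \<le> H * L ^ k" if "p \<in> space \<mu>" for p
      using close[of p] that by (simp add: abs_minus_commute)
  qed
  then have step3: "\<bar>(\<integral>x. u x \<partial>marginal_x \<mu>) - (\<integral>p. g p \<partial>\<mu>)\<bar> \<le> H * L ^ k"
    by (simp add: marg integral_comp_Fn[OF g])
  have "\<bar>\<integral>p. f p \<partial>leb_Q\<bar> \<le> A"
    using measurable_leb_Q[OF f] bf by (intro Q.abs_integral_le) auto
  then have step4: "\<bar>(\<integral>x. u x \<partial>marginal_x \<mu>) * (\<integral>p. f p \<partial>leb_Q)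
      - (\<integral>p. g p \<partial>\<mu>) * (\<integral>p. f p \<partial>leb_Q)\<bar> \<le> H * L ^ k * A"
    using step3 H L_pos unfolding left_diff_distrib[symmetric] abs_mult
    by (intro mult_mono) auto
  show ?thesis
    using step1 step2 step4 unfolding fubini1 fubini2[symmetric]
    by (simp add: algebra_simps)
qed

text \<open>Half of the time goes to flattening and half to the base dynamics, so the rate
  \<open>L\<close> is met at about n/2, that is, as \<open>\<rho> ^ n\<close>.\<close>

definition \<rho> :: real where "\<rho> = sqrt L"

text \<open>The first summand comes from the two flattening errors, with a division by
  \<open>\<rho>\<close> for rounding when n is odd; the second comes from the base.\<close>

definition A\<^sub>0 :: real where "A\<^sub>0 = 2 / \<rho> + C\<^sub>0"

lemma rho_bounds: "0 < \<rho>" "\<rho> < 1" and rho_sq: "\<rho> * \<rho> = L"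
  using L_pos L_less by (auto simp: \<rho>_def)

lemma A\<^sub>0_ge: "2 \<le> A\<^sub>0"
  using rho_bounds C\<^sub>0_pos by (simp add: A\<^sub>0_def add_increasing2 divide_simps)

text \<open>Balances the two errors of \<open>skew_equilibrium_split\<close> by halving the time.
  Time 0 is included because the auxiliary time \<open>m\<close> in \<open>correlation_bound\<close>
  may vanish.\<close>

lemma skew_equilibrium:
  assumes f: "f \<in> borel_measurable borel_Q" and g: "g \<in> borel_measurable borel_Q"
    and bf: "\<And>p. p \<in> unit_Q \<Longrightarrow> \<bar>f p\<bar> \<le> A" and bg: "\<And>p. p \<in> unit_Q \<Longrightarrow> \<bar>g p\<bar> \<le> B"
    and lip: "\<And>x y1 y2. x \<in> unit_I \<Longrightarrow> y1 \<in> unit_I \<Longrightarrow> y2 \<in> unit_I \<Longrightarrow>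
      \<bar>g (x, y2) - g (x, y1)\<bar> \<le> H * \<bar>y2 - y1\<bar>"
    and H: "0 \<le> H" and Nf: "N (proj_x f) < \<infinity>"
  shows "\<bar>(\<integral>p. f p * g ((F ^^ n) p) \<partial>leb_Q) - (\<integral>p. g p \<partial>\<mu>) * (\<integral>p. f p \<partial>leb_Q)\<bar>
      \<le> A\<^sub>0 * \<rho> ^ n * (B + H) * (A + enn2real (N (proj_x f)))"
proof -
  define R where "R = enn2real (N (proj_x f))"
  have R: "0 \<le> R" by (simp add: R_def)
  have 00: "(0::real, 0::real) \<in> unit_Q" by (simp add: unit_Q_def unit_I_def)
  have A: "0 \<le> A" using bf[OF 00] by linarith
  have B: "0 \<le> B" using bg[OF 00] by linarith
  show ?thesis
  proof (cases n)
    case 0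
    interpret Q: prob_space leb_Q by (rule prob_space_leb_Q)
    \<comment> \<open>At time 0 the base estimate says nothing; each of the two terms is at most
      \<open>A * B\<close>, and \<open>A\<^sub>0_ge\<close> covers their sum.\<close>
    have "\<bar>\<integral>p. f p * g p \<partial>leb_Q\<bar> \<le> A * B"
      using measurable_leb_Q[OF f] measurable_leb_Q[OF g] bf bg
      by (intro Q.abs_integral_le) (auto simp: abs_mult A intro!: mult_mono)
    moreover have "\<bar>\<integral>p. g p \<partial>\<mu>\<bar> * \<bar>\<integral>p. f p \<partial>leb_Q\<bar> \<le> B * A"
      using measurable_leb_Q[OF f] measurable_mu[OF g] bf bg
      by (intro mult_mono Q.abs_integral_le abs_integral_le B) auto
    ultimately have "\<bar>(\<integral>p. f p * g p \<partial>leb_Q) - (\<integral>p. g p \<partial>\<mu>) * (\<integral>p. f p \<partial>leb_Q)\<bar> \<le> 2 * B * A"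
      unfolding abs_mult[symmetric] by (simp add: mult.commute)
    also have "\<dots> \<le> A\<^sub>0 * (B + H) * (A + R)"
      using A\<^sub>0_ge A B H R by (intro mult_mono) auto
    finally show ?thesis by (simp add: 0 R_def)
  next
    case (Suc n')
    \<comment> \<open>Rounding \<open>k\<close> down keeps \<open>j\<close> at least 1, as the base
      estimate demands; the cost is one factor \<open>\<rho>\<close> in the bound for
      \<open>L ^ k\<close>.\<close>
    define k where "k = n div 2"
    define j where "j = n - k"
    have n: "n = j + k" and j1: "1 \<le> j" and nj: "n \<le> 2 * j" and nk: "n \<le> Suc (2 * k)"
      by (auto simp: j_def k_def Suc)
    have pow: "L ^ i = \<rho> ^ (2 * i)" for i
      by (simp add: power_mult power2_eq_square rho_sq)
    have Lj: "L ^ j \<le> \<rho> ^ n"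
      unfolding pow using rho_bounds nj by (intro power_decreasing) auto
    have "\<rho> ^ Suc (2 * k) \<le> \<rho> ^ n"
      using rho_bounds nk by (intro power_decreasing) auto
    then have Lk: "L ^ k \<le> \<rho> ^ n / \<rho>"
      unfolding pow using rho_bounds by (simp add: field_simps)
    have "2 * A * H * L ^ k + C\<^sub>0 * L ^ j * B * R
        \<le> 2 * A * H * (\<rho> ^ n / \<rho>) + C\<^sub>0 * \<rho> ^ n * B * R"
      using Lj Lk A B H R C\<^sub>0_pos rho_bounds
      by (intro add_mono mult_right_mono mult_left_mono) auto
    also have "\<dots> = \<rho> ^ n * (2 / \<rho> * (H * A) + C\<^sub>0 * (B * R))"
      by (simp add: algebra_simps)
    also have "\<dots> \<le> \<rho> ^ n * (2 / \<rho> * ((B + H) * (A + R)) + C\<^sub>0 * ((B + H) * (A + R)))"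
      using A B H R C\<^sub>0_pos rho_bounds by (intro mult_left_mono add_mono mult_mono) auto
    also have "\<dots> = A\<^sub>0 * \<rho> ^ n * (B + H) * (A + R)"
      using rho_bounds by (simp add: A\<^sub>0_def field_simps)
    finally show ?thesis
      using skew_equilibrium_split[OF f g bf bg lip H Nf j1, of k] by (simp add: n R_def)
  qed
qed

section \<open>Correlations with respect to the invariant measure\<close>

text \<open>Three uses of \<open>skew_equilibrium\<close> pass from \<open>\<mu>\<close> to Lebesgue
  measure and back. The auxiliary time \<open>m\<close> stays free: the spare factor
  \<open>\<rho> ^ n\<close> on the middle term is meant to beat the growth in \<open>m\<close> of
  the norm of the composed observable.\<close>

lemma correlation_bound:
  assumes f: "f \<in> borel_measurable borel_Q" and g: "g \<in> borel_measurable borel_Q"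
    and bf: "\<And>p. p \<in> unit_Q \<Longrightarrow> \<bar>f p\<bar> \<le> A" and bg: "\<And>p. p \<in> unit_Q \<Longrightarrow> \<bar>g p\<bar> \<le> B"
    and lipf: "\<And>x y1 y2. x \<in> unit_I \<Longrightarrow> y1 \<in> unit_I \<Longrightarrow> y2 \<in> unit_I \<Longrightarrow>
      \<bar>f (x, y2) - f (x, y1)\<bar> \<le> E * \<bar>y2 - y1\<bar>"
    and lipg: "\<And>x y1 y2. x \<in> unit_I \<Longrightarrow> y1 \<in> unit_I \<Longrightarrow> y2 \<in> unit_I \<Longrightarrow>
      \<bar>g (x, y2) - g (x, y1)\<bar> \<le> H * \<bar>y2 - y1\<bar>"
    and E: "0 \<le> E" and H: "0 \<le> H"
    and N1: "N (proj_x (\<lambda>_. 1)) < \<infinity>" and Nf: "N (proj_x (f \<circ> (F ^^ m))) < \<infinity>"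
  shows "\<bar>(\<integral>p. f p * g ((F ^^ n) p) \<partial>\<mu>) - (\<integral>p. g p \<partial>\<mu>) * (\<integral>p. f p \<partial>\<mu>)\<bar>
      \<le> A\<^sub>0 * \<rho> ^ m * (B + H) * (2 * (A + E) * (1 + enn2real (N (proj_x (\<lambda>_. 1))))
          + \<rho> ^ n * (A + enn2real (N (proj_x (f \<circ> (F ^^ m))))))"
proof -
  define R where "R = enn2real (N (proj_x (f \<circ> (F ^^ m))))"
  define R1 where "R1 = enn2real (N (proj_x (\<lambda>_. 1)))"
  define h where "h p = f p * g ((F ^^ n) p)" for p
  define fm where "fm = f \<circ> (F ^^ m)"
  interpret Q: prob_space leb_Q by (rule prob_space_leb_Q)
  have R: "0 \<le> R" "0 \<le> R1" by (simp_all add: R_def R1_def)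
  have 00: "(0::real, 0::real) \<in> unit_Q" by (simp add: unit_Q_def unit_I_def)
  have A: "0 \<le> A" using bf[OF 00] by linarith
  have B: "0 \<le> B" using bg[OF 00] by linarith
  have h: "h \<in> borel_measurable borel_Q"
    unfolding h_def using f measurable_compose[OF Fn_meas g] by (intro borel_measurable_times) auto
  have bh: "\<bar>h p\<bar> \<le> A * B" if "p \<in> unit_Q" for p
    unfolding h_def abs_mult using bf[OF that] bg[OF Fn_in_Q[OF that]] A by (intro mult_mono) auto
  \<comment> \<open>Product rule along a leaf; contraction bounds the Lipschitz constant of the
    iterated factor by \<open>H\<close> for every \<open>n\<close>.\<close>
  have liph: "\<bar>h (x, y2) - h (x, y1)\<bar> \<le> (A * H + E * B) * \<bar>y2 - y1\<bar>"
    if I: "x \<in> unit_I" "y1 \<in> unit_I" "y2 \<in> unit_I" for x y1 y2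
  proof -
    define a where "a = g ((F ^^ n) (x, y2))"
    define b where "b = g ((F ^^ n) (x, y1))"
    have "\<bar>a - b\<bar> \<le> H * L ^ n * \<bar>y2 - y1\<bar>"
      unfolding a_def b_def using I by (intro abs_diff_comp_Fn_le lipg H)
    also have "\<dots> \<le> H * 1 * \<bar>y2 - y1\<bar>"
      using H L_pos L_less by (intro mult_right_mono mult_left_mono power_le_one) auto
    finally have ab: "\<bar>a - b\<bar> \<le> H * \<bar>y2 - y1\<bar>" by simp
    have b: "\<bar>b\<bar> \<le> B"
      unfolding b_def using I by (intro bg Fn_in_Q) (simp add: unit_Q_def)
    have "h (x, y2) - h (x, y1) = f (x, y2) * (a - b) + (f (x, y2) - f (x, y1)) * b"
      by (simp add: h_def a_def b_def algebra_simps)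
    also have "\<bar>\<dots>\<bar> \<le> \<bar>f (x, y2)\<bar> * \<bar>a - b\<bar> + \<bar>f (x, y2) - f (x, y1)\<bar> * \<bar>b\<bar>"
      unfolding abs_mult[symmetric] by (rule abs_triangle_ineq)
    also have "\<dots> \<le> A * (H * \<bar>y2 - y1\<bar>) + E * \<bar>y2 - y1\<bar> * B"
      using ab b bf[of "(x, y2)"] lipf[OF I] I A E
      by (intro add_mono mult_mono) (auto simp: unit_Q_def)
    finally show ?thesis by (simp add: algebra_simps)
  qed
  have one_bound: "\<bar>1\<bar> \<le> (1::real)" by simp
  have mass: "measure leb_Q unit_Q = 1" using Q.prob_space by simp
  \<comment> \<open>Here the first observable is the constant density 1, so Lebesgue measure itself
    is transported towards \<open>\<mu>\<close>; hence the constant \<open>R1\<close>.\<close>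
  have "\<bar>(\<integral>p. h ((F ^^ m) p) \<partial>leb_Q) - (\<integral>p. h p \<partial>\<mu>)\<bar>
      \<le> A\<^sub>0 * \<rho> ^ m * (A * B + (A * H + E * B)) * (1 + R1)"
    using skew_equilibrium[of "\<lambda>_. 1" h 1 "A * B" "A * H + E * B" m, OF _ h one_bound bh liph _ N1]
      A B E H mass by (simp add: R1_def)
  \<comment> \<open>Adding the missing product \<open>E * H\<close> makes the norm of
    \<open>h\<close> factor.\<close>
  also have "\<dots> \<le> A\<^sub>0 * \<rho> ^ m * ((B + H) * (A + E)) * (1 + R1)"
    using A B E H R A\<^sub>0_ge rho_bounds
    by (intro mult_right_mono mult_left_mono) (auto simp: algebra_simps)
  finally have step1: "\<bar>(\<integral>p. h ((F ^^ m) p) \<partial>leb_Q) - (\<integral>p. h p \<partial>\<mu>)\<bar>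
      \<le> A\<^sub>0 * \<rho> ^ m * ((B + H) * (A + E)) * (1 + R1)" .
  have fm: "fm \<in> borel_measurable borel_Q"
    unfolding fm_def using Fn_meas f by (rule measurable_comp)
  have bfm: "\<bar>fm p\<bar> \<le> A" if "p \<in> unit_Q" for p
    unfolding fm_def using bf[OF Fn_in_Q[OF that]] by simp
  \<comment> \<open>Regrouping puts the shift by \<open>m\<close> into the first observable, so
    \<open>g\<close> is seen at time \<open>n + m\<close>.\<close>
  have "h ((F ^^ m) p) = fm p * g ((F ^^ (n + m)) p)" for p
    by (simp add: h_def fm_def funpow_add)
  then have step2: "\<bar>(\<integral>p. h ((F ^^ m) p) \<partial>leb_Q) - (\<integral>p. g p \<partial>\<mu>) * (\<integral>p. fm p \<partial>leb_Q)\<bar>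
      \<le> A\<^sub>0 * \<rho> ^ m * (B + H) * (\<rho> ^ n * (A + R))"
    using skew_equilibrium[OF fm g bfm bg lipg H Nf[folded fm_def], of "n + m"]
    by (simp add: R_def fm_def power_add mult_ac)
  \<comment> \<open>Density 1 again, now to recover the \<open>\<mu>\<close>-integral of
    \<open>f\<close>.\<close>
  have step3: "\<bar>(\<integral>p. fm p \<partial>leb_Q) - (\<integral>p. f p \<partial>\<mu>)\<bar> \<le> A\<^sub>0 * \<rho> ^ m * (A + E) * (1 + R1)"
    using skew_equilibrium[of "\<lambda>_. 1" f 1 A E m, OF _ f one_bound bf lipf E N1] mass
    by (simp add: R1_def fm_def)
  have "\<bar>\<integral>p. g p \<partial>\<mu>\<bar> \<le> B"
    using measurable_mu[OF g] bg by (intro abs_integral_le) auto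
  then have "\<bar>\<integral>p. g p \<partial>\<mu>\<bar> * \<bar>(\<integral>p. fm p \<partial>leb_Q) - (\<integral>p. f p \<partial>\<mu>)\<bar>
      \<le> (B + H) * (A\<^sub>0 * \<rho> ^ m * (A + E) * (1 + R1))"
    using step3 H B by (intro mult_mono) auto
  then have step4: "\<bar>(\<integral>p. g p \<partial>\<mu>) * (\<integral>p. fm p \<partial>leb_Q) - (\<integral>p. g p \<partial>\<mu>) * (\<integral>p. f p \<partial>\<mu>)\<bar>
      \<le> (B + H) * (A\<^sub>0 * \<rho> ^ m * (A + E) * (1 + R1))"
    by (simp add: abs_mult[symmetric] right_diff_distrib)
  have "\<bar>(\<integral>p. h p \<partial>\<mu>) - (\<integral>p. g p \<partial>\<mu>) * (\<integral>p. f p \<partial>\<mu>)\<bar>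
      \<le> A\<^sub>0 * \<rho> ^ m * ((B + H) * (A + E)) * (1 + R1) + A\<^sub>0 * \<rho> ^ m * (B + H) * (\<rho> ^ n * (A + R))
        + (B + H) * (A\<^sub>0 * \<rho> ^ m * (A + E) * (1 + R1))"
    using step1 step2 step4 by linarith
  also have "\<dots> = A\<^sub>0 * \<rho> ^ m * (B + H) * (2 * (A + E) * (1 + R1) + \<rho> ^ n * (A + R))"
    by (simp add: algebra_simps)
  finally show ?thesis by (simp add: h_def R_def R1_def)
qed

end

section \<open>Choice of constants and exponential decay\<close>

theorem theorem2:
  fixes F :: "real \<times> real \<Rightarrow> real \<times> real"
    and T :: "real \<Rightarrow> real"
    and G :: "real \<times> real \<Rightarrow> real"
    and \<mu> :: "(real \<times> real) measure"
    and N :: "(real \<Rightarrow> real) \<Rightarrow> ennreal"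
    and S :: "(real \<times> real \<Rightarrow> real) \<Rightarrow> ennreal"
  assumes F_borel: "F \<in> borel_Q \<rightarrow>\<^sub>M borel_Q"
    and F_skew: "\<And>x y. x \<in> unit_I \<Longrightarrow> y \<in> unit_I \<Longrightarrow> F (x, y) = (T x, G (x, y))"
    and mu_prob: "prob_space \<mu>"
    and mu_sets: "sets \<mu> = sets borel_Q"
    and mu_inv: "distr \<mu> \<mu> F = \<mu>"
    and mux_inv: "distr (marginal_x \<mu>) (marginal_x \<mu>) T = marginal_x \<mu>"
    and mux_ac: "absolutely_continuous leb_I (marginal_x \<mu>)"
    and N_norm: "ext_norm_on_I N"
    and N_one: "N (\<lambda>_. 1) < \<infinity>"
    and S_seminorm: "ext_seminorm_on unit_Q S"
    and equilibrium: "exp_convergence_to_equilibrium T (marginal_x \<mu>) N"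
    and nonsing: "nonsingular_I T"
    and piecewise: "piecewise_homeo_I T"
    and contraction: "\<exists>L<1. \<forall>x\<in>unit_I. L-lipschitz_on unit_I (\<lambda>y. G (x, y))"
    and growth: "iterate_norm_growth F N S"
  shows "exp_decay_of_correlations F \<mu> N S"
proof -
  interpret mu: prob_space \<mu> by (rule mu_prob)
  interpret I: prob_space leb_I by (rule prob_space_leb_I)
  have T_meas: "T \<in> borel_I \<rightarrow>\<^sub>M borel_I"
    using nonsing by (simp add: nonsingular_I_def)
  have fst_mu: "fst \<in> \<mu> \<rightarrow>\<^sub>M borel_I"
    using measurable_fst_borel_Q measurable_cong_sets[OF mu_sets refl] by blast
  interpret nu: prob_space "marginal_x \<mu>"
    unfolding marginal_x_def using fst_mu by (rule mu.prob_space_distr)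
  have sets_nu: "sets (marginal_x \<mu>) = sets borel_I"
    by (simp add: marginal_x_def)
  have space_nu: "space (marginal_x \<mu>) = unit_I"
    by (simp add: marginal_x_def)
  obtain C0 L0 where C0: "0 < C0" and L0: "0 < L0" "L0 < 1"
    and eq: "\<And>f g n. 1 \<le> n \<Longrightarrow> integrable leb_I f \<Longrightarrow> integrable (marginal_x \<mu>) g \<Longrightarrow>
      Linf_norm g < \<infinity> \<Longrightarrow> N f < \<infinity> \<Longrightarrow>
      ennreal \<bar>(\<integral>x. f x * g ((T ^^ n) x) \<partial>leb_I) - (\<integral>x. g x \<partial>marginal_x \<mu>) * (\<integral>x. f x \<partial>leb_I)\<bar>
        \<le> ennreal (C0 * L0 ^ n) * Linf_norm g * N f"
    using equilibrium unfolding exp_convergence_to_equilibrium_def by blast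
  obtain L1 where L1: "L1 < 1" and lip: "\<And>x. x \<in> unit_I \<Longrightarrow> L1-lipschitz_on unit_I (\<lambda>y. G (x, y))"
    using contraction by blast
  \<comment> \<open>The contraction constant may be 0; the maximum with \<open>L0\<close> keeps
    \<open>L\<close> positive.\<close>
  define L where "L = max L0 L1"
  have L: "0 < L" "L < 1" "L0 \<le> L" "L1 \<le> L"
    using L0 L1 by (auto simp: L_def)
  interpret skew_contraction \<mu> F T G N L C0
  proof
    show "L-lipschitz_on unit_I (\<lambda>y. G (x, y))" if "x \<in> unit_I" for x
      using lipschitz_on_le[OF lip[OF that] L(4)] .
    fix f g :: "real \<Rightarrow> real" and n :: nat and B :: real
    assume f: "integrable leb_I f" and g: "g \<in> borel_measurable borel_I"
      and bg: "\<And>x. x \<in> unit_I \<Longrightarrow> \<bar>g x\<bar> \<le> B" and Nf: "N f < \<infinity>" and n: "1 \<le> n"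
    have B: "0 \<le> B" using bg[of 0] by (simp add: unit_I_def)
    have "g \<in> borel_measurable (marginal_x \<mu>)"
      using g measurable_cong_sets[OF sets_nu refl] by blast
    then have int_g: "integrable (marginal_x \<mu>) g"
      using bg space_nu by (intro nu.integrable_bounded) auto
    have "g \<in> borel_measurable leb_I"
      using g measurable_cong_sets[OF sets_leb_I refl] by blast
    \<comment> \<open>A pointwise bound dominates the essential supremum, which converts the
      extended estimate into the real one of the locale.\<close>
    then have Linf: "Linf_norm g \<le> ennreal B"
      unfolding Linf_norm_def using bg
      by (intro esssup_I AE_I2) (auto intro!: ennreal_leI)
    then have "Linf_norm g < \<infinity>"
      using le_less_trans[OF _ ennreal_less_top] by simp
    note eq[OF n f int_g this Nf]
    also have "ennreal (C0 * L0 ^ n) * Linf_norm g * N f \<le> ennreal (C0 * L ^ n) * ennreal B * N f"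
      using Linf C0 L0 L by (intro mult_mono ennreal_leI power_mono) auto
    also have "\<dots> = ennreal (C0 * L ^ n * B * enn2real (N f))"
      using Nf B C0 L(1) by (simp add: ennreal_mult ennreal_enn2real less_top)
    finally show "\<bar>(\<integral>x. f x * g ((T ^^ n) x) \<partial>leb_I) - (\<integral>x. g x \<partial>marginal_x \<mu>) * (\<integral>x. f x \<partial>leb_I)\<bar>
        \<le> C0 * L ^ n * B * enn2real (N f)"
      using B C0 L(1) by (subst (asm) ennreal_le_iff) auto
  qed (fact F_borel T_meas F_skew mu_sets mu_inv L C0)+
  \<comment> \<open>\<open>N_one\<close> makes convergence to equilibrium applicable to Lebesgue
    measure, viewed as the density 1.\<close>
  have "proj_x (\<lambda>_. 1) = (\<lambda>_. 1)"
    using I.prob_space by (simp add: proj_x_def fun_eq_iff)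
  then have N1: "N (proj_x (\<lambda>_. 1)) < \<infinity>" using N_one by simp
  define R1 where "R1 = enn2real (N (proj_x (\<lambda>_. 1)))"
  have R1: "0 \<le> R1" by (simp add: R1_def)
  obtain C K where CK: "\<And>f n. f \<in> borel_measurable borel_Q \<Longrightarrow> 1 \<le> n \<Longrightarrow> N (proj_x f) < \<infinity> \<Longrightarrow>
      ylip_norm f < \<infinity> \<Longrightarrow> S f < \<infinity> \<Longrightarrow>
      N (proj_x (f \<circ> (F ^^ n))) + S (f \<circ> (F ^^ n))
        \<le> ennreal (C * K ^ n) * (N (proj_x f) + ylip_norm f + S f)"
    using growth unfolding iterate_norm_growth_def by blast
  \<comment> \<open>The given constants may be negative or small. Raising them to at least 1 makes
    the growth bound valid at time 0 too, where it compares \<open>f\<close> with itself.\<close>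
  define C1 where "C1 = max 1 \<bar>C\<bar>"
  define K1 where "K1 = max 1 \<bar>K\<bar>"
  have C1: "1 \<le> C1" and K1: "1 \<le> K1" by (auto simp: C1_def K1_def)
  have growth': "N (proj_x (f \<circ> (F ^^ n))) \<le> ennreal (C1 * K1 ^ n) * (N (proj_x f) + ylip_norm f + S f)"
    if f: "f \<in> borel_measurable borel_Q" "N (proj_x f) < \<infinity>" "ylip_norm f < \<infinity>" "S f < \<infinity>" for f n
  proof (cases "n = 0")
    case True
    have "N (proj_x f) \<le> 1 * (N (proj_x f) + ylip_norm f + S f)"
      by (simp add: add.assoc)
    also have "\<dots> \<le> ennreal C1 * (N (proj_x f) + ylip_norm f + S f)"
      using C1 by (intro mult_right_mono) (auto simp: ennreal_ge_1)
    finally show ?thesis using True by simp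
  next
    case False
    have "C * K ^ n \<le> \<bar>C\<bar> * \<bar>K\<bar> ^ n"
      by (metis abs_ge_self abs_mult power_abs)
    also have "\<dots> \<le> C1 * K1 ^ n"
      by (intro mult_mono power_mono) (auto simp: C1_def K1_def)
    finally have *: "ennreal (C * K ^ n) \<le> ennreal (C1 * K1 ^ n)" by (rule ennreal_leI)
    have "N (proj_x (f \<circ> (F ^^ n))) \<le> N (proj_x (f \<circ> (F ^^ n))) + S (f \<circ> (F ^^ n))"
      by simp
    also have "\<dots> \<le> ennreal (C * K ^ n) * (N (proj_x f) + ylip_norm f + S f)"
      using f False by (intro CK) auto
    also have "\<dots> \<le> ennreal (C1 * K1 ^ n) * (N (proj_x f) + ylip_norm f + S f)"
      using * by (rule mult_right_mono) simp
    finally show ?thesis .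
  qed
  \<comment> \<open>A fixed number of steps at rate \<open>\<rho>\<close> outweighs one step of
    growth by \<open>K1\<close>. The successor below makes \<open>p\<close> positive, as needed for
    division by \<open>p\<close> and for the \<open>p\<close>-th root.\<close>
  obtain q where q: "\<rho> ^ q < 1 / K1"
    using real_arch_pow_inv[of "1 / K1" \<rho>] rho_bounds K1 by auto
  define p where "p = Suc q"
  have "\<rho> ^ p \<le> \<rho> ^ q"
    unfolding p_def using rho_bounds by (intro power_decreasing) auto
  then have "\<rho> ^ p \<le> 1 / K1"
    using q by linarith
  then have p: "K1 * \<rho> ^ p \<le> 1" and p0: "0 < p"
    using K1 by (simp_all add: field_simps p_def)
  \<comment> \<open>With \<open>m\<close> about n/p, the rate \<open>\<rho> ^ m\<close> becomes
    \<open>\<sigma> ^ n\<close>.\<close>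
  define \<sigma> where "\<sigma> = root p \<rho>"
  have \<sigma>: "0 < \<sigma>" "\<sigma> < 1" "\<sigma> ^ p = \<rho>"
    using rho_bounds p0 by (auto simp: \<sigma>_def)
  \<comment> \<open>The division by \<open>\<rho>\<close> pays for rounding \<open>m\<close> down;
    in the bracket, the first term stems from the two uses of density 1, and \<open>1 + C1\<close>
    from the middle term.\<close>
  define C2 where "C2 = A\<^sub>0 / \<rho> * (2 * (1 + R1) + 1 + C1)"
  have C2: "0 < C2"
    unfolding C2_def using A\<^sub>0_ge rho_bounds R1 C1 by (intro mult_pos_pos divide_pos_pos) auto
  have decay: "ennreal \<bar>(\<integral>p. f p * g ((F ^^ n) p) \<partial>\<mu>) - (\<integral>p. g p \<partial>\<mu>) * (\<integral>p. f p \<partial>\<mu>)\<bar>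
      \<le> ennreal (C2 * \<sigma> ^ n) * ylip_norm g * (ylip_norm f + N (proj_x f) + S f)"
    if f: "f \<in> borel_measurable borel_Q" and g: "g \<in> borel_measurable borel_Q"
      and yg: "ylip_norm g < \<infinity>" and yf: "ylip_norm f < \<infinity>"
      and Nf: "N (proj_x f) < \<infinity>" and Sf: "S f < \<infinity>" for f g n
  proof -
    define m where "m = n div p"
    define A where "A = enn2real (sup_norm_Q f)"
    define E where "E = enn2real (Lip_y f)"
    define B where "B = enn2real (sup_norm_Q g)"
    define H where "H = enn2real (Lip_y g)"
    define \<Phi> where "\<Phi> = enn2real (N (proj_x f)) + (A + E) + enn2real (S f)"
    have nonneg: "0 \<le> A" "0 \<le> E" "0 \<le> B" "0 \<le> H"
      by (simp_all add: A_def E_def B_def H_def)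
    have A_le: "A + E \<le> \<Phi>" "0 \<le> \<Phi>"
      using nonneg by (simp_all add: \<Phi>_def)
    have fin: "sup_norm_Q f < \<infinity>" "Lip_y f < \<infinity>" "sup_norm_Q g < \<infinity>" "Lip_y g < \<infinity>"
      using yf yg by (simp_all add: ylip_norm_def)
    have yf': "ylip_norm f = ennreal (A + E)" and yg': "ylip_norm g = ennreal (B + H)"
      using fin by (simp_all add: ylip_norm_def A_def E_def B_def H_def)
    have \<Phi>: "N (proj_x f) + ylip_norm f + S f = ennreal \<Phi>"
      using Nf Sf nonneg by (simp add: yf' \<Phi>_def)
    have "N (proj_x (f \<circ> (F ^^ m))) \<le> ennreal (C1 * K1 ^ m) * ennreal \<Phi>"
      using growth'[OF f Nf yf Sf, of m] \<Phi> by simp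
    also have "\<dots> = ennreal (C1 * K1 ^ m * \<Phi>)"
      using C1 K1 A_le by (simp add: ennreal_mult)
    finally have NFm: "N (proj_x (f \<circ> (F ^^ m))) \<le> ennreal (C1 * K1 ^ m * \<Phi>)" .
    then have NFm_fin: "N (proj_x (f \<circ> (F ^^ m))) < \<infinity>"
      using le_less_trans[OF _ ennreal_less_top] by simp
    define R where "R = enn2real (N (proj_x (f \<circ> (F ^^ m))))"
    have R: "R \<le> C1 * K1 ^ m * \<Phi>"
      unfolding R_def using NFm C1 K1 A_le by (intro enn2real_leI) auto
    \<comment> \<open>The growth \<open>K1 ^ m\<close> is absorbed here: n steps contain
      \<open>m\<close> blocks of length \<open>p\<close>, each of which cancels one factor
      \<open>K1\<close>.\<close>
    have "\<rho> ^ n \<le> \<rho> ^ (p * m)"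
      using rho_bounds by (intro power_decreasing) (auto simp: m_def)
    then have "K1 ^ m * \<rho> ^ n \<le> (K1 * \<rho> ^ p) ^ m"
      using K1 by (simp add: power_mult_distrib power_mult mult_left_mono)
    also have "\<dots> \<le> 1"
      using p K1 rho_bounds by (intro power_le_one) auto
    finally have absorb: "K1 ^ m * \<rho> ^ n \<le> 1" .
    have "\<rho> ^ n * R \<le> \<rho> ^ n * (C1 * K1 ^ m * \<Phi>)"
      using R rho_bounds by (intro mult_left_mono) auto
    also have "\<dots> = (K1 ^ m * \<rho> ^ n) * (C1 * \<Phi>)" by simp
    also have "\<dots> \<le> 1 * (C1 * \<Phi>)"
      using absorb C1 A_le by (intro mult_right_mono) auto
    finally have R': "\<rho> ^ n * R \<le> C1 * \<Phi>" by simp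
    have "\<rho> ^ n * A \<le> 1 * \<Phi>"
      using rho_bounds nonneg A_le by (intro mult_mono power_le_one) auto
    with R' have mid: "\<rho> ^ n * (A + R) \<le> (1 + C1) * \<Phi>"
      by (simp add: algebra_simps)
    \<comment> \<open>Rounding loses less than one block, hence at most one factor
      \<open>\<rho>\<close>.\<close>
    have "n \<le> p * (m + 1)"
      using p0 by (metis add.commute dividend_less_times_div less_imp_le m_def mult_Suc_right Suc_eq_plus1)
    then have "\<sigma> ^ (p * (m + 1)) \<le> \<sigma> ^ n"
      using \<sigma> by (intro power_decreasing) auto
    then have m_le: "\<rho> ^ m \<le> \<sigma> ^ n / \<rho>"
      using rho_bounds \<sigma> unfolding power_mult by (simp add: field_simps)
    have "\<bar>(\<integral>p. f p * g ((F ^^ n) p) \<partial>\<mu>) - (\<integral>p. g p \<partial>\<mu>) * (\<integral>p. f p \<partial>\<mu>)\<bar>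
        \<le> A\<^sub>0 * \<rho> ^ m * (B + H) * (2 * (A + E) * (1 + R1) + \<rho> ^ n * (A + R))"
      unfolding R1_def R_def
      by (rule correlation_bound[OF f g _ _ _ _ nonneg(2) nonneg(4) N1 NFm_fin])
        (use fin in \<open>auto simp: A_def B_def E_def H_def intro!: abs_le_sup_norm_Q abs_diff_le_Lip_y\<close>)
    also have "\<dots> \<le> A\<^sub>0 * \<rho> ^ m * (B + H) * (2 * \<Phi> * (1 + R1) + (1 + C1) * \<Phi>)"
      using mid A_le A\<^sub>0_ge rho_bounds nonneg R1
      by (intro mult_left_mono add_mono mult_right_mono) auto
    also have "\<dots> = A\<^sub>0 * \<rho> ^ m * ((B + H) * (2 * \<Phi> * (1 + R1) + (1 + C1) * \<Phi>))"
      by (simp only: mult.assoc)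
    also have "\<dots> \<le> A\<^sub>0 * (\<sigma> ^ n / \<rho>) * ((B + H) * (2 * \<Phi> * (1 + R1) + (1 + C1) * \<Phi>))"
      using m_le A\<^sub>0_ge nonneg A_le R1 C1 by (intro mult_right_mono mult_left_mono) auto
    also have "\<dots> = C2 * \<sigma> ^ n * (B + H) * \<Phi>"
      using rho_bounds by (simp add: C2_def field_simps)
    finally have "ennreal \<bar>(\<integral>p. f p * g ((F ^^ n) p) \<partial>\<mu>) - (\<integral>p. g p \<partial>\<mu>) * (\<integral>p. f p \<partial>\<mu>)\<bar>
        \<le> ennreal (C2 * \<sigma> ^ n * (B + H) * \<Phi>)"
      by (rule ennreal_leI)
    also have "\<dots> = ennreal (C2 * \<sigma> ^ n) * ylip_norm g * (N (proj_x f) + ylip_norm f + S f)"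
      unfolding yg' \<Phi> using C2 \<sigma> nonneg A_le by (simp add: ennreal_mult)
    finally show ?thesis by (simp add: ac_simps)
  qed
  show ?thesis
    unfolding exp_decay_of_correlations_def
    using C2 \<sigma>(1,2) decay by (intro exI[of _ C2] exI[of _ \<sigma>]) blast
qed

end
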